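(* $$[\mathbb{O}^-]\circledcirc[\mathrm{SO}(2)\oplus\mathbb{Z}_2^c]=\{[\mathbb{1}],[\mathbb{Z}_3],[\mathbb{Z}_2^-],[\mathbb{Z}_4^-]\}.$$
   Context: $[K]$ is the conjugacy class of a subgroup $K$ in $\mathrm{O}(3)$, and the clips operation is $[H_1]\circledcirc[H_2]=\{[H_1\cap gH_2g^{-1}]:g\in\mathrm{O}(3)\}$. $(e_1,e_2,e_3)$ is the canonical basis of $\mathbb{R}^3$, $\mathbf{r}(n,\theta)$ is the rotation by angle $\theta$ about the axis directed by $n\neq0$. $\mathbb{1}=\{\mathrm{Id}\}$; $\mathbb{Z}_2^c=\{\pm\mathrm{Id}\}$; $H\oplus\mathbb{Z}_2^c=H\cup(-H)$ for $H\subset\mathrm{SO}(3)$; $\mathbb{Z}_k=\{\mathbf{r}(e_3,2j\pi/k):0\le j\le k-1\}$; $\mathbb{Z}_{2k}^-=\mathbb{Z}_k\cup(-\mathbf{r}(e_3,\pi/k))\mathbb{Z}_k$ for $k\ge1$; $\mathrm{SO}(2)=\{\mathbf{r}(e_3,\theta):\theta\in[0,2\pi]\}$. $\mathbb{T}$ is the rotation group of the regular tetrahedron (order 12), generated by $\mathbf{r}(e_3,\pi),\mathbf{r}(e_1,\pi),\mathbf{r}(e_1+e_2+e_3,2\pi/3)$, and $\mathbb{O}^-=\mathbb{T}\cup(-\mathbf{r}(e_3,\pi/2))\mathbb{T}$. *)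

theory Defs
  imports "HOL-Analysis.Analysis" "HOL-Algebra.Algebra"
begin

definition O3 :: "(real^3^3) monoid"
  where "O3 = \<lparr>carrier = {A. orthogonal_matrix A}, mult = (**), one = mat 1\<rparr>"

lemma O3_group: "group O3"
proof (rule groupI)
  fix A assume "A \<in> carrier O3"
  then show "\<exists>B\<in>carrier O3. B \<otimes>\<^bsub>O3\<^esub> A = \<one>\<^bsub>O3\<^esub>"
    by (intro bexI[of _ "transpose A"]) (auto simp: O3_def orthogonal_matrix_def)
qed (auto simp: O3_def orthogonal_matrix_mul orthogonal_matrix_id matrix_mul_assoc)

definition conj_subgroup :: "real^3^3 \<Rightarrow> (real^3^3) set \<Rightarrow> (real^3^3) set"
  where "conj_subgroup g K = (\<lambda>h. g \<otimes>\<^bsub>O3\<^esub> h \<otimes>\<^bsub>O3\<^esub> inv\<^bsub>O3\<^esub> g) ` K"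

definition conj_class :: "(real^3^3) set \<Rightarrow> (real^3^3) set set"
  where "conj_class K = {conj_subgroup g K | g. g \<in> carrier O3}"

text \<open>The clips operation acts on conjugacy classes. All representatives are allowed;
  the lemma \<open>clips_conj_class\<close> below shows that the result can be
  computed from any fixed pair of subgroups representing the two classes.\<close>

definition clips :: "(real^3^3) set set \<Rightarrow> (real^3^3) set set \<Rightarrow> (real^3^3) set set set"
  where "clips C1 C2 = {conj_class (H1 \<inter> conj_subgroup g H2) | H1 H2 g.
    subgroup H1 O3 \<and> subgroup H2 O3 \<and> C1 = conj_class H1 \<and> C2 = conj_class H2 \<and> g \<in> carrier O3}"

lemma conj_subgroup_mult:
  assumes "g \<in> carrier O3" "h \<in> carrier O3" "K \<subseteq> carrier O3"
  shows "conj_subgroup g (conj_subgroup h K) = conj_subgroup (g \<otimes>\<^bsub>O3\<^esub> h) K"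
proof -
  interpret group O3 by (rule O3_group)
  show ?thesis
    unfolding conj_subgroup_def image_image
    using assms by (intro image_cong refl) (auto simp: m_assoc inv_mult_group)
qed

lemma conj_subgroup_one:
  assumes "K \<subseteq> carrier O3"
  shows "conj_subgroup \<one>\<^bsub>O3\<^esub> K = K"
proof -
  interpret group O3 by (rule O3_group)
  have "conj_subgroup \<one>\<^bsub>O3\<^esub> K = (\<lambda>h. h) ` K"
    unfolding conj_subgroup_def using assms by (intro image_cong refl) auto
  then show ?thesis by simp
qed

lemma conj_subgroup_closed:
  assumes "g \<in> carrier O3" "K \<subseteq> carrier O3"
  shows "conj_subgroup g K \<subseteq> carrier O3"
proof -
  interpret group O3 by (rule O3_group)
  show ?thesis using assms by (auto simp: conj_subgroup_def)
qed

lemma conj_subgroup_Int: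
  assumes "g \<in> carrier O3" "H \<subseteq> carrier O3" "K \<subseteq> carrier O3"
  shows "conj_subgroup g (H \<inter> K) = conj_subgroup g H \<inter> conj_subgroup g K"
proof -
  interpret group O3 by (rule O3_group)
  have "inj_on (\<lambda>h. g \<otimes>\<^bsub>O3\<^esub> h \<otimes>\<^bsub>O3\<^esub> inv\<^bsub>O3\<^esub> g) (carrier O3)"
    using assms by (auto simp: inj_on_def)
  then show ?thesis
    unfolding conj_subgroup_def using assms by (intro inj_on_image_Int) auto
qed

lemma conj_class_conj_subgroup:
  assumes "g \<in> carrier O3" "K \<subseteq> carrier O3"
  shows "conj_class (conj_subgroup g K) = conj_class K"
proof -
  interpret group O3 by (rule O3_group)
  have "\<exists>h'\<in>carrier O3. conj_subgroup h K = conj_subgroup h' (conj_subgroup g K)"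
    if "h \<in> carrier O3" for h
    using that assms
    by (intro bexI[of _ "h \<otimes>\<^bsub>O3\<^esub> inv\<^bsub>O3\<^esub> g"]) (auto simp: conj_subgroup_mult m_assoc)
  moreover have "\<exists>h'\<in>carrier O3. conj_subgroup h (conj_subgroup g K) = conj_subgroup h' K"
    if "h \<in> carrier O3" for h
    using that assms by (intro bexI[of _ "h \<otimes>\<^bsub>O3\<^esub> g"]) (auto simp: conj_subgroup_mult)
  ultimately show ?thesis
    unfolding conj_class_def by blast
qed

lemma clips_conj_class:
  assumes "subgroup H1 O3" "subgroup H2 O3"
  shows "clips (conj_class H1) (conj_class H2) =
    {conj_class (H1 \<inter> conj_subgroup g H2) | g. g \<in> carrier O3}"
proof (intro equalityI subsetI)
  interpret group O3 by (rule O3_group)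
  have sub: "H1 \<subseteq> carrier O3" "H2 \<subseteq> carrier O3"
    using assms subgroup.subset by blast+
  have rep: "\<exists>a\<in>carrier O3. K = conj_subgroup a H"
    if "subgroup K O3" "conj_class H = conj_class K" for H K
  proof -
    have "K = conj_subgroup \<one>\<^bsub>O3\<^esub> K"
      using that(1) conj_subgroup_one subgroup.subset by metis
    then have "K \<in> conj_class K"
      unfolding conj_class_def using one_closed by blast
    then have "K \<in> conj_class H"
      using that(2) by simp
    then show ?thesis
      by (auto simp: conj_class_def)
  qed
  fix x assume "x \<in> clips (conj_class H1) (conj_class H2)"
  then obtain K1 K2 g where K: "subgroup K1 O3" "subgroup K2 O3"
      "conj_class H1 = conj_class K1" "conj_class H2 = conj_class K2" "g \<in> carrier O3"
    and x: "x = conj_class (K1 \<inter> conj_subgroup g K2)"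
    unfolding clips_def by blast
  obtain a b where a: "a \<in> carrier O3" "K1 = conj_subgroup a H1"
    and b: "b \<in> carrier O3" "K2 = conj_subgroup b H2"
    using rep K by metis
  define c where "c = inv\<^bsub>O3\<^esub> a \<otimes>\<^bsub>O3\<^esub> (g \<otimes>\<^bsub>O3\<^esub> b)"
  have c: "c \<in> carrier O3" "a \<otimes>\<^bsub>O3\<^esub> c = g \<otimes>\<^bsub>O3\<^esub> b"
    using a(1) b(1) K(5) by (simp_all add: c_def m_assoc[symmetric])
  have "K1 \<inter> conj_subgroup g K2 = conj_subgroup a (H1 \<inter> conj_subgroup c H2)"
    using a b c K(5) sub by (simp add: conj_subgroup_Int conj_subgroup_closed conj_subgroup_mult)
  then have "x = conj_class (H1 \<inter> conj_subgroup c H2)"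
    using x a(1) sub by (simp add: conj_class_conj_subgroup le_infI1)
  then show "x \<in> {conj_class (H1 \<inter> conj_subgroup g H2) | g. g \<in> carrier O3}"
    using c(1) by blast
next
  fix x assume "x \<in> {conj_class (H1 \<inter> conj_subgroup g H2) | g. g \<in> carrier O3}"
  then show "x \<in> clips (conj_class H1) (conj_class H2)"
    unfolding clips_def using assms by blast
qed

text \<open>Rodrigues' formula for the right-handed rotation by the angle \<open>\<theta>\<close> about the axis
  directed by \<open>n\<close>. The vector \<open>n \<noteq> 0\<close> need not be a unit vector: \<open>sgn n = n /\<^sub>R norm n\<close>.\<close>

definition rot :: "real^3 \<Rightarrow> real \<Rightarrow> real^3^3"
  where "rot n \<theta> = matrix (\<lambda>x. cos \<theta> *\<^sub>R x + sin \<theta> *\<^sub>R cross3 (sgn n) x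
    + ((1 - cos \<theta>) * (sgn n \<bullet> x)) *\<^sub>R sgn n)"

definition e1 :: "real^3" where "e1 = axis 1 1"
definition e2 :: "real^3" where "e2 = axis 2 1"
definition e3 :: "real^3" where "e3 = axis 3 1"

definition trivial_subgroup :: "(real^3^3) set"
  where "trivial_subgroup = {mat 1}"

definition plus_Z2c :: "(real^3^3) set \<Rightarrow> (real^3^3) set"
  where "plus_Z2c H = H \<union> uminus ` H"

definition cyclic :: "nat \<Rightarrow> (real^3^3) set"
  where "cyclic k = {rot e3 (2 * real j * pi / real k) | j. j < k}"

text \<open>\<open>cyclic_minus k\<close> is the group \<open>\<int>\<^sub>2\<^sub>k\<^sup>-\<close> of order \<open>2 * k\<close>;
  the argument is half of the conventional index.\<close>

definition cyclic_minus :: "nat \<Rightarrow> (real^3^3) set"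
  where "cyclic_minus k = cyclic k \<union> ((- rot e3 (pi / real k)) <#\<^bsub>O3\<^esub> cyclic k)"

definition SO2 :: "(real^3^3) set"
  where "SO2 = {rot e3 \<theta> | \<theta>. \<theta> \<in> {0..2 * pi}}"

definition tetrahedral :: "(real^3^3) set"
  where "tetrahedral = generate O3 {rot e3 pi, rot e1 pi, rot (e1 + e2 + e3) (2 * pi / 3)}"

definition octahedral_minus :: "(real^3^3) set"
  where "octahedral_minus = tetrahedral \<union> ((- rot e3 (pi / 2)) <#\<^bsub>O3\<^esub> tetrahedral)"

end

theory Submission
  imports Defs
begin

text \<open>
  The group \<open>SO(2) \<oplus> \<int>\<^sub>2\<^sup>c\<close> consists of the orthogonal \<open>A\<close> with \<open>A e\<^sub>3 = det A e\<^sub>3\<close>: it is the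
  stabilizer of \<open>e\<^sub>3\<close> when \<open>O(3)\<close> acts on pseudovectors by \<open>n \<mapsto> det A \<cdot> A n\<close>
  (\<open>plus_Z2c_SO2_eq\<close>). Conjugating by \<open>g\<close> replaces \<open>e\<^sub>3\<close> by \<open>g e\<^sub>3\<close>
  (\<open>conj_subgroup_axial\<close>), which can be any unit vector. The clips set is
  therefore the set of classes of the stabilizers in \<open>\<bbbO>\<^sup>-\<close> of unit pseudovectors \<open>n\<close>
  (\<open>clips_eq_stabilizers\<close>).

  In coordinates, \<open>\<bbbO>\<^sup>-\<close> is the group of signed permutation matrices whose three signs
  multiply to \<open>1\<close> (\<open>octahedral_minus_eq\<close>). It is normalized by all signed permutation matrices,
  so \<open>n\<close> may be moved by one of them without changing the class
  of its stabilizer; this reduces to the chamber \<open>0 \<le> n\<^sub>1 \<le> n\<^sub>2 \<le> n\<^sub>3\<close>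
  (\<open>conj_class_stabilizer_invariant\<close>, \<open>move_to_chamber\<close>).

  In the chamber, \<open>A n = det A n\<close> forces a nontrivial \<open>A\<close> to be one of six matrices, each of
  which pins \<open>n\<close> to a single ray (\<open>stabilizer_chamber_cases\<close>):
  \<open>(0,0,1)\<close>, the axis of a rotoinversion of order four, with stabilizer \<open>\<int>\<^sub>4\<^sup>-\<close>;
  \<open>(0,1,1)\<close>, the normal of a mirror, with stabilizer conjugate to \<open>\<int>\<^sub>2\<^sup>-\<close>; and
  \<open>(1,1,1)\<close>, a threefold axis, with stabilizer conjugate to \<open>\<int>\<^sub>3\<close>.
  Every other nonzero \<open>n\<close> in the chamber has trivial stabilizer.
\<close>

section \<open>Signed permutation matrices\<close>

lemmas matrix3_simps = vec_eq_iff forall_3 sum_3 matrix_matrix_mult_def matrix_vector_mult_def transpose_def mat_def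

text \<open>Oriented this way, the rule would turn \<open>transpose A *v x\<close> into \<open>x v* A\<close> and keep
  products of the form \<open>transpose A ** A\<close> from being recognized.\<close>

declare transpose_matrix_vector [simp del]

definition signed_perm :: "('n \<Rightarrow> 'n) \<Rightarrow> ('n \<Rightarrow> real) \<Rightarrow> real^'n^'n"
  where "signed_perm p s = (\<chi> i j. if j = p i then s i else 0)"

definition hyperoctahedral :: "(real^'n^'n) set"
  where "hyperoctahedral = {signed_perm p s | p s. bij p \<and> (\<forall>i. s i = 1 \<or> s i = -1)}"

definition evenly_signed :: "(real^'n^'n) set"
  where "evenly_signed = {signed_perm p s | p s. bij p \<and> (\<forall>i. s i = 1 \<or> s i = -1) \<and> prod s UNIV = 1}"

lemma signed_perm_mult_vec: "(signed_perm p s *v x) $ i = s i * x $ p i"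
proof -
  have "(signed_perm p s *v x) $ i = (\<Sum>j\<in>UNIV. if j = p i then s i * x $ j else 0)"
    unfolding matrix_vector_mult_def signed_perm_def vec_lambda_beta
    by (intro sum.cong refl) simp
  then show ?thesis by simp
qed

lemma signed_perm_mult: "signed_perm p s ** signed_perm q t = signed_perm (q \<circ> p) (\<lambda>i. s i * t (p i))"
  by (simp add: matrix_eq vec_eq_iff signed_perm_mult_vec matrix_vector_mul_assoc[symmetric])

lemma transpose_signed_perm:
  assumes "bij p"
  shows "transpose (signed_perm p s) = signed_perm (inv_into UNIV p) (s \<circ> inv_into UNIV p)"
proof -
  have "j = p i \<longleftrightarrow> i = inv_into UNIV p j" for i j
    using assms by (metis bij_inv_eq_iff)
  then show ?thesis
    by (auto simp: signed_perm_def transpose_def vec_eq_iff)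
qed

lemma signed_perm_id: "signed_perm id (\<lambda>_. 1) = mat 1"
  by (auto simp: signed_perm_def mat_def vec_eq_iff)

lemma hyperoctahedral_orthogonal:
  assumes "A \<in> hyperoctahedral" shows "orthogonal_matrix A"
proof -
  obtain p s where A: "A = signed_perm p s" "bij p" and s: "\<forall>i. s i = 1 \<or> s i = -1"
    using assms by (auto simp: hyperoctahedral_def)
  have "s i * s i = 1" for i using s[rule_format, of i] by auto
  then have "transpose A ** A = signed_perm id (\<lambda>_. 1)"
    using A bij_is_surj[OF A(2)] by (simp add: transpose_signed_perm signed_perm_mult surj_iff)
  then show ?thesis
    by (simp add: orthogonal_matrix signed_perm_id)
qed

lemma evenly_signed_subset: "evenly_signed \<subseteq> hyperoctahedral"
  by (auto simp: evenly_signed_def hyperoctahedral_def)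

text \<open>Permuting the signs of the second factor does not change their product.\<close>

lemma evenly_signed_mult:
  assumes "A \<in> evenly_signed" "B \<in> evenly_signed" shows "A ** B \<in> evenly_signed"
proof -
  obtain p s where A: "A = signed_perm p s" "bij p" "\<forall>i. s i = 1 \<or> s i = -1" "prod s UNIV = 1"
    using assms by (auto simp: evenly_signed_def)
  obtain q t where B: "B = signed_perm q t" "bij q" "\<forall>i. t i = 1 \<or> t i = -1" "prod t UNIV = 1"
    using assms by (auto simp: evenly_signed_def)
  have "(\<Prod>i\<in>UNIV. t (p i)) = prod t UNIV"
    using A(2) by (rule prod.reindex_bij_betw)
  then have "(\<Prod>i\<in>UNIV. s i * t (p i)) = 1"
    by (simp add: prod.distrib A B)
  moreover have "\<forall>i. s i * t (p i) = 1 \<or> s i * t (p i) = -1"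
    using A(3) B(3) by (metis mult_1 mult_minus1 minus_minus)
  ultimately show ?thesis
    unfolding evenly_signed_def A(1) B(1) signed_perm_mult using A(2) B(2) by (blast intro: bij_comp)
qed

text \<open>The signs of \<open>B\<close> occur twice in \<open>B A B\<^sup>T\<close>, so they cancel in the product of all signs.
  This is why the full hyperoctahedral group may be used to normalize the pseudovector, although only
  half of it lies in \<open>\<bbbO>\<^sup>-\<close>.\<close>

lemma evenly_signed_conjugate:
  assumes "B \<in> hyperoctahedral" "A \<in> evenly_signed" shows "B ** A ** transpose B \<in> evenly_signed"
proof -
  obtain p s where A: "A = signed_perm p s" "bij p" "\<forall>i. s i = 1 \<or> s i = -1" "prod s UNIV = 1"
    using assms by (auto simp: evenly_signed_def)
  obtain q t where B: "B = signed_perm q t" "bij q" "\<forall>i. t i = 1 \<or> t i = -1"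
    using assms by (auto simp: hyperoctahedral_def)
  define u where "u = (\<lambda>i. t i * s (q i) * t (inv_into UNIV q (p (q i))))"
  have 1: "(\<Prod>i\<in>UNIV. s (q i)) = prod s UNIV"
    using B(2) by (rule prod.reindex_bij_betw)
  have "bij (\<lambda>i. inv_into UNIV q (p (q i)))"
    using bij_comp[OF bij_comp[OF B(2) A(2)] bij_imp_bij_inv[OF B(2)]] by (simp add: o_def)
  then have 2: "(\<Prod>i\<in>UNIV. t (inv_into UNIV q (p (q i)))) = prod t UNIV"
    by (rule prod.reindex_bij_betw)
  have "t i * t i = 1" for i using B(3)[rule_format, of i] by auto
  then have "prod t UNIV * prod t UNIV = 1"
    by (simp add: prod.distrib[symmetric])
  then have "prod u UNIV = 1"
    by (simp add: u_def prod.distrib 1 2 A)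
  moreover have "\<forall>i. u i = 1 \<or> u i = -1"
    unfolding u_def using A(3) B(3) by (metis mult_1 mult_minus1 minus_minus)
  moreover have "B ** A ** transpose B = signed_perm (inv_into UNIV q \<circ> (p \<circ> q)) u"
    by (simp add: B A transpose_signed_perm signed_perm_mult u_def o_def)
  moreover have "bij (inv_into UNIV q \<circ> (p \<circ> q))"
    using A B by (intro bij_comp bij_imp_bij_inv)
  ultimately show ?thesis
    unfolding evenly_signed_def by blast
qed

lemma evenly_signed_transpose:
  assumes "A \<in> evenly_signed" shows "transpose A \<in> evenly_signed"
proof -
  obtain p s where A: "A = signed_perm p s" "bij p" "\<forall>i. s i = 1 \<or> s i = -1" "prod s UNIV = 1"
    using assms by (auto simp: evenly_signed_def)
  have "prod (s \<circ> inv_into UNIV p) UNIV = prod s UNIV"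
    using prod.reindex_bij_betw[OF bij_imp_bij_inv[OF A(2)], of s] by (simp add: o_def)
  then show ?thesis
    unfolding evenly_signed_def A(1) transpose_signed_perm[OF A(2)]
    using A by (auto intro!: bij_imp_bij_inv exI[of _ "inv_into UNIV p"] exI[of _ "s \<circ> inv_into UNIV p"])
qed

lemma O3_mult: "A \<otimes>\<^bsub>O3\<^esub> B = A ** B"
  by (simp add: O3_def)

lemma O3_inv:
  assumes "orthogonal_matrix g" shows "inv\<^bsub>O3\<^esub> g = transpose g"
proof -
  interpret group O3 by (rule O3_group)
  show ?thesis
    by (rule inv_equality) (use assms in \<open>auto simp: O3_def orthogonal_matrix_def\<close>)
qed

lemma evenly_signed_subgroup: "subgroup evenly_signed O3"
proof -
  interpret group O3 by (rule O3_group)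
  have "mat 1 \<in> (evenly_signed :: (real^3^3) set)"
    unfolding signed_perm_id[symmetric] evenly_signed_def by (intro CollectI exI[of _ id] exI[of _ "\<lambda>_. 1"]) auto
  then show ?thesis
    using hyperoctahedral_orthogonal evenly_signed_subset evenly_signed_mult evenly_signed_transpose
    by (intro subgroupI) (auto simp: O3_def O3_inv[unfolded O3_def] subset_iff)
qed

section \<open>Rotations about an axis and pseudovector stabilizers\<close>

lemma rot_apply: "rot n \<theta> *v x = cos \<theta> *\<^sub>R x + sin \<theta> *\<^sub>R cross3 (sgn n) x
    + ((1 - cos \<theta>) * (sgn n \<bullet> x)) *\<^sub>R sgn n"
proof -
  have "linear (\<lambda>x. cos \<theta> *\<^sub>R x + sin \<theta> *\<^sub>R cross3 (sgn n) x
    + ((1 - cos \<theta>) * (sgn n \<bullet> x)) *\<^sub>R sgn n)"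
    by (rule linearI) (auto simp: algebra_simps cross3_simps inner_add_right)
  then show ?thesis unfolding rot_def by (simp add: matrix_works)
qed

lemma orthogonal_matrix_inner:
  fixes g :: "real^'n^'n"
  assumes "orthogonal_matrix g" shows "(g *v x) \<bullet> (g *v y) = x \<bullet> y"
proof -
  have "(g *v x) \<bullet> (g *v y) = ((g *v x) v* g) \<bullet> y"
    by (rule dot_lmul_matrix[symmetric])
  also have "(g *v x) v* g = (transpose g ** g) *v x"
    by (simp only: matrix_vector_mul_assoc[symmetric] transpose_matrix_vector)
  finally show ?thesis
    using assms by (simp add: orthogonal_matrix_def)
qed

lemma orthogonal_matrix_norm: "orthogonal_matrix g \<Longrightarrow> norm (g *v x) = norm x" for g :: "real^'n^'n"
  by (simp add: norm_eq_sqrt_inner orthogonal_matrix_inner)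

text \<open>An orthogonal map respects the cross product up to its determinant. The sign appears as a
  reversal of the angle.\<close>

lemma conjugate_rot:
  assumes "orthogonal_matrix g"
  shows "g ** rot n \<theta> ** transpose g = rot (g *v n) (det g * \<theta>)"
proof -
  have d: "det g = 1 \<or> det g = -1" using assms by (rule det_orthogonal_matrix)
  have gt: "g *v (transpose g *v x) = x" "transpose g *v (g *v x) = x" for x
    using assms by (simp_all add: matrix_vector_mul_assoc orthogonal_matrix_def)
  have sg: "sgn (g *v n) = g *v sgn n"
    by (simp add: sgn_div_norm orthogonal_matrix_norm[OF assms] matrix_vector_mult_scaleR)
  have "(g ** rot n \<theta> ** transpose g) *v x = rot (g *v n) (det g * \<theta>) *v x" for x
  proof -
    define y where "y = transpose g *v x"
    have x: "x = g *v y" by (simp add: y_def gt)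
    have "(g ** rot n \<theta> ** transpose g) *v x = g *v (rot n \<theta> *v y)"
      by (simp only: matrix_vector_mul_assoc[symmetric] y_def)
    also have "\<dots> = cos \<theta> *\<^sub>R (g *v y) + sin \<theta> *\<^sub>R (g *v cross3 (sgn n) y)
        + ((1 - cos \<theta>) * (sgn n \<bullet> y)) *\<^sub>R (g *v sgn n)"
      by (simp only: rot_apply matrix_vector_right_distrib matrix_vector_mult_scaleR)
    also have "g *v cross3 (sgn n) y = det g *\<^sub>R cross3 (g *v sgn n) (g *v y)"
      using d by (auto simp: cross_orthogonal_matrix[OF assms])
    also have "cos \<theta> = cos (det g * \<theta>)"
      using d by auto
    also have "sin \<theta> *\<^sub>R det g *\<^sub>R cross3 (g *v sgn n) (g *v y)
        = sin (det g * \<theta>) *\<^sub>R cross3 (g *v sgn n) (g *v y)"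
      using d by auto
    finally show ?thesis
      unfolding x rot_apply sg orthogonal_matrix_inner[OF assms] .
  qed
  then show ?thesis by (simp add: matrix_eq)
qed

text \<open>Entries of the Rodrigues matrix, from which each concrete rotation is evaluated.\<close>

lemma rot_matrix:
  fixes n defines "u \<equiv> sgn n"
  shows "rot n \<theta> = vector [
    vector [cos \<theta> + (1 - cos \<theta>) * (u$1 * u$1), (1 - cos \<theta>) * (u$1 * u$2) - sin \<theta> * u$3, (1 - cos \<theta>) * (u$1 * u$3) + sin \<theta> * u$2],
    vector [(1 - cos \<theta>) * (u$2 * u$1) + sin \<theta> * u$3, cos \<theta> + (1 - cos \<theta>) * (u$2 * u$2), (1 - cos \<theta>) * (u$2 * u$3) - sin \<theta> * u$1],
    vector [(1 - cos \<theta>) * (u$3 * u$1) - sin \<theta> * u$2, (1 - cos \<theta>) * (u$3 * u$2) + sin \<theta> * u$1, cos \<theta> + (1 - cos \<theta>) * (u$3 * u$3)]]"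
    (is "_ = ?R")
proof -
  have "rot n \<theta> *v x = ?R *v x" for x
    unfolding rot_apply u_def[symmetric]
    by (simp add: vec_eq_iff forall_3 matrix_vector_mult_def sum_3 vector_3 cross3_def inner_vec_def algebra_simps)
  then show ?thesis by (simp add: matrix_eq)
qed

lemma rot_e3: "rot e3 \<theta> = vector [vector [cos \<theta>, - sin \<theta>, 0], vector [sin \<theta>, cos \<theta>, 0], vector [0, 0, 1]]"
proof -
  have "sgn e3 = e3" by (simp add: e3_def sgn_div_norm)
  then show ?thesis by (simp add: rot_matrix) (simp add: e3_def axis_def)
qed

text \<open>If \<open>A\<close> fixes \<open>e\<^sub>3\<close>, so does \<open>A\<^sup>T\<close>, its inverse. Hence the third row and column of \<open>A\<close>
  are those of the identity, and the remaining block is a \<open>2 \<times> 2\<close> rotation.\<close>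

lemma fixes_e3_imp_SO2:
  assumes o: "orthogonal_matrix A" and d: "det A = 1" and a: "A *v e3 = e3"
  shows "A \<in> SO2"
proof -
  have o1: "transpose A ** A = mat 1" using o by (simp add: orthogonal_matrix)
  have "transpose A *v e3 = transpose A *v (A *v e3)" using a by simp
  also have "\<dots> = e3" by (simp add: matrix_vector_mul_assoc o1)
  finally have at: "transpose A *v e3 = e3" .
  have c: "A$1$3 = 0" "A$2$3 = 0" "A$3$3 = 1"
    using a by (simp_all add: matrix3_simps e3_def axis_def)
  have r: "A$3$1 = 0" "A$3$2 = 0"
    using at by (simp_all add: matrix3_simps e3_def axis_def)
  have n: "(A$1$1)^2 + (A$2$1)^2 = 1" "A$1$1 * A$1$2 + A$2$1 * A$2$2 = 0"
    using o1 c r by (simp_all add: matrix3_simps power2_eq_square)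
  have dd: "A$1$1 * A$2$2 - A$1$2 * A$2$1 = 1"
    using d c r by (simp add: det_3)
  have 12: "A$1$2 = - A$2$1" and 22: "A$2$2 = A$1$1"
  proof -
    let ?a = "A$1$1" and ?b = "A$2$1" and ?p = "A$1$2" and ?q = "A$2$2"
    have "?p = ?p * (?a^2 + ?b^2)" using n by simp
    also have "\<dots> = ?a * (?a * ?p + ?b * ?q) - ?b * (?a * ?q - ?p * ?b)"
      by (simp add: algebra_simps power2_eq_square)
    finally show "?p = - ?b" using n dd by simp
    have "?q = ?q * (?a^2 + ?b^2)" using n by simp
    also have "\<dots> = ?b * (?a * ?p + ?b * ?q) + ?a * (?a * ?q - ?p * ?b)"
      by (simp add: algebra_simps power2_eq_square)
    finally show "?q = ?a" using n dd by simp
  qed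
  obtain t where t: "0 \<le> t" "t < 2*pi" "A$1$1 = cos t" "A$2$1 = sin t"
    using sincos_total_2pi[OF n(1)] by metis
  have "rot e3 t = A"
    unfolding rot_e3 using c r t 12 22 by (simp add: vec_eq_iff forall_3)
  then show ?thesis using t by (auto simp: SO2_def)
qed

text \<open>The stabilizer of \<open>n\<close> regarded as a pseudovector: since \<open>det A = \<plusminus>1\<close>, the equation says
  \<open>det A \<cdot> A n = n\<close>.\<close>

definition axial :: "real^3 \<Rightarrow> (real^3^3) set"
  where "axial n = {A. orthogonal_matrix A \<and> A *v n = det A *\<^sub>R n}"

lemma conj_subgroup_O3:
  assumes "orthogonal_matrix g"
  shows "conj_subgroup g K = (\<lambda>h. g ** h ** transpose g) ` K"
  by (simp add: conj_subgroup_def O3_inv[OF assms] O3_mult)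

lemma orthogonal_matrix_uminus: "orthogonal_matrix (- A) = orthogonal_matrix A" for A :: "real^3^3"
  by (simp add: orthogonal_matrix matrix3_simps)

lemma axial_uminus: "- A \<in> axial n \<longleftrightarrow> A \<in> axial n"
proof -
  have "det (- A) = - det A" by (simp add: det_3)
  moreover have "- A *v n = - (A *v n)" by (simp add: vec_eq_iff matrix_vector_mult_def sum_negf)
  ultimately show ?thesis by (simp add: axial_def orthogonal_matrix_uminus)
qed

lemma rot_e3_axial: "rot e3 t \<in> axial e3"
proof -
  have "orthogonal_matrix (rot e3 t)"
    by (simp add: orthogonal_matrix rot_e3 matrix3_simps power2_eq_square[symmetric])
  moreover have "det (rot e3 t) = 1"
    by (simp add: rot_e3 det_3 power2_eq_square[symmetric])
  moreover have "rot e3 t *v e3 = e3"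
    unfolding rot_e3 by (simp add: matrix3_simps e3_def axis_def)
  ultimately show ?thesis
    by (simp add: axial_def)
qed

text \<open>Up to sign an orthogonal matrix is a rotation, and \<open>-A\<close> fixes the pseudovector
  exactly when \<open>A\<close> does.\<close>

lemma plus_Z2c_SO2_eq: "plus_Z2c SO2 = axial e3"
proof (intro equalityI subsetI)
  fix A assume "A \<in> plus_Z2c SO2"
  then obtain t where t: "A = rot e3 t \<or> A = - rot e3 t"
    by (auto simp: plus_Z2c_def SO2_def)
  with rot_e3_axial[of t] show "A \<in> axial e3"
    using axial_uminus by blast
next
  fix A assume A: "A \<in> axial e3"
  consider "det A = 1" | "det A = -1"
    using A det_orthogonal_matrix by (auto simp: axial_def)
  then show "A \<in> plus_Z2c SO2"
  proof cases
    case 1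
    then show ?thesis using A fixes_e3_imp_SO2 by (simp add: axial_def plus_Z2c_def)
  next
    case 2
    then have "det (- A) = 1" by (simp add: det_3)
    moreover have "- A \<in> axial e3" using A axial_uminus by blast
    ultimately have "- A \<in> SO2" using fixes_e3_imp_SO2 by (simp add: axial_def)
    then show ?thesis unfolding plus_Z2c_def by (metis UnI2 image_eqI minus_minus)
  qed
qed

lemma axial_subgroup: "subgroup (axial n) O3"
proof -
  interpret group O3 by (rule O3_group)
  have "transpose A \<in> axial n" if "A \<in> axial n" for A
  proof -
    have A: "orthogonal_matrix A" "A *v n = det A *\<^sub>R n" using that by (auto simp: axial_def)
    have "n = transpose A *v (A *v n)"
      using A(1) by (simp add: matrix_vector_mul_assoc orthogonal_matrix_def)
    then have "n = det A *\<^sub>R (transpose A *v n)"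
      by (simp add: A(2) matrix_vector_mult_scaleR)
    then have "transpose A *v n = det A *\<^sub>R n"
      using det_orthogonal_matrix[OF A(1)] by (metis minus_minus scaleR_minus1_left scaleR_one)
    then show ?thesis using A by (simp add: axial_def)
  qed
  moreover have "A ** B \<in> axial n" if "A \<in> axial n" "B \<in> axial n" for A B
    using that by (simp add: axial_def orthogonal_matrix_mul det_mul matrix_vector_mul_assoc[symmetric]
        matrix_vector_mult_scaleR mult.commute)
  moreover have "mat 1 \<in> axial n"
    by (simp add: axial_def orthogonal_matrix_id)
  moreover have "axial n \<subseteq> carrier O3"
    by (auto simp: axial_def O3_def)
  ultimately show ?thesis
    by (intro subgroupI) (auto simp: axial_def O3_inv, auto simp: O3_def)
qed

lemma conj_subgroup_axial:
  assumes g: "orthogonal_matrix g"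
  shows "conj_subgroup g (axial n) = axial (g *v n)"
proof -
  have sub: "g ** A ** transpose g \<in> axial (g *v n)" if "A \<in> axial n" "orthogonal_matrix g" for A g n
  proof -
    have gg: "transpose g ** g = mat 1" and d: "det g * det g = 1"
      using that det_orthogonal_matrix[of g] by (auto simp: orthogonal_matrix_def)
    have "g ** A ** transpose g *v (g *v n) = g *v (A *v ((transpose g ** g) *v n))"
      by (simp only: matrix_vector_mul_assoc matrix_mul_assoc)
    then show ?thesis
      using that d gg
      by (simp add: axial_def orthogonal_matrix_mul det_mul matrix_vector_mult_scaleR mult.commute
          mult.left_commute)
  qed
  have "\<exists>B\<in>axial n. A = g ** B ** transpose g" if "A \<in> axial (g *v n)" for A
  proof
    have gg: "transpose g ** g = mat 1" "g ** transpose g = mat 1"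
      using g by (auto simp: orthogonal_matrix_def)
    show "transpose g ** A ** g \<in> axial n"
      using sub[OF that, of "transpose g"] g gg by (simp add: matrix_vector_mul_assoc)
    have "g ** (transpose g ** A ** g) ** transpose g = (g ** transpose g) ** A ** (g ** transpose g)"
      by (simp only: matrix_mul_assoc)
    then show "A = g ** (transpose g ** A ** g) ** transpose g"
      by (simp add: gg)
  qed
  then show ?thesis
    using sub[OF _ g] by (auto simp: conj_subgroup_O3[OF g])
qed

lemma hyperoctahedral_transpose:
  assumes "A \<in> hyperoctahedral" shows "transpose A \<in> hyperoctahedral"
proof -
  obtain p s where A: "A = signed_perm p s" "bij p" "\<forall>i. s i = 1 \<or> s i = -1"
    using assms by (auto simp: hyperoctahedral_def)
  then show ?thesis
    unfolding hyperoctahedral_def A(1) transpose_signed_perm[OF A(2)]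
    by (auto intro!: bij_imp_bij_inv exI[of _ "inv_into UNIV p"] exI[of _ "s \<circ> inv_into UNIV p"])
qed

lemma conj_subgroup_evenly_signed:
  assumes "B \<in> hyperoctahedral" shows "conj_subgroup B evenly_signed = evenly_signed"
proof -
  have B: "orthogonal_matrix B" using assms by (rule hyperoctahedral_orthogonal)
  then have BB: "B ** transpose B = mat 1" by (simp add: orthogonal_matrix_def)
  have "\<exists>C\<in>evenly_signed. A = B ** C ** transpose B" if "A \<in> evenly_signed" for A
  proof
    show "transpose B ** A ** B \<in> evenly_signed"
      using evenly_signed_conjugate[OF hyperoctahedral_transpose[OF assms] that] by simp
    have "B ** (transpose B ** A ** B) ** transpose B = (B ** transpose B) ** A ** (B ** transpose B)"
      by (simp only: matrix_mul_assoc)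
    then show "A = B ** (transpose B ** A ** B) ** transpose B"
      by (simp add: BB)
  qed
  then show ?thesis
    using evenly_signed_conjugate[OF assms] by (auto simp: conj_subgroup_O3[OF B])
qed

section \<open>The group \<open>\<bbbO>\<^sup>-\<close> in coordinates\<close>

text \<open>Signs and permutations on three indices, given by their values at \<open>1, 2, 3\<close>.\<close>

definition triple :: "'a \<Rightarrow> 'a \<Rightarrow> 'a \<Rightarrow> 3 \<Rightarrow> 'a"
  where "triple a b c i = (if i = 1 then a else if i = 2 then b else c)"

lemma triple_simps [simp]: "triple a b c 1 = a" "triple a b c 2 = b" "triple a b c 3 = c"
  by (simp_all add: triple_def)

lemma triple_eta: "triple (f 1) (f 2) (f 3) = f"
  by (simp add: fun_eq_iff forall_3)

lemma bij_triple: "bij (triple a b c) \<longleftrightarrow> a \<noteq> b \<and> a \<noteq> c \<and> b \<noteq> (c::3)"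
proof -
  have "bij (triple a b c) \<longleftrightarrow> inj (triple a b c)"
    using finite_UNIV_inj_surj[of "triple a b c"] by (auto simp: bij_def)
  then show ?thesis by (auto simp: inj_def forall_3)
qed

definition even_perms :: "(3 \<times> 3 \<times> 3) set"
  where "even_perms = {(1,2,3), (2,3,1), (3,1,2)}"
definition odd_perms :: "(3 \<times> 3 \<times> 3) set"
  where "odd_perms = {(2,1,3), (1,3,2), (3,2,1)}"
definition even_signs :: "(real \<times> real \<times> real) set"
  where "even_signs = {(1,1,1), (1,-1,-1), (-1,1,-1), (-1,-1,1)}"

lemma prod_UNIV_3: "prod f (UNIV :: 3 set) = f 1 * f 2 * f 3"
  unfolding UNIV_3 by (simp add: ac_simps)

lemma bij_triple_iff: "bij (triple a b c) \<longleftrightarrow> (a,b,c) \<in> even_perms \<union> odd_perms"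
  unfolding bij_triple even_perms_def odd_perms_def
  using exhaust_3[of a] exhaust_3[of b] exhaust_3[of c] by (elim disjE; simp)

text \<open>The 24 elements: six permutations times four sign patterns of product \<open>1\<close>.\<close>

lemma evenly_signed_iff:
  "A \<in> evenly_signed \<longleftrightarrow> (\<exists>a b c x y z. A = signed_perm (triple a b c) (triple x y z) \<and> (a,b,c) \<in> even_perms \<union> odd_perms \<and> (x,y,z) \<in> even_signs)"
  (is "_ = ?R")
proof
  assume "A \<in> evenly_signed"
  then obtain p s where A: "A = signed_perm p s" "bij p" "\<forall>i. s i = 1 \<or> s i = -1" "prod s UNIV = 1"
    by (auto simp: evenly_signed_def)
  have "A = signed_perm (triple (p 1) (p 2) (p 3)) (triple (s 1) (s 2) (s 3))"
    by (simp add: triple_eta A)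
  moreover have "(p 1, p 2, p 3) \<in> even_perms \<union> odd_perms"
    unfolding bij_triple_iff[symmetric] triple_eta by fact
  moreover have "(s 1, s 2, s 3) \<in> even_signs"
    using A(3)[unfolded forall_3] A(4)[unfolded prod_UNIV_3]
    by (elim conjE disjE) (simp_all add: even_signs_def)
  ultimately show ?R by blast
next
  assume ?R
  then obtain a b c x y z where A: "A = signed_perm (triple a b c) (triple x y z)"
     "bij (triple a b c)" "(x,y,z) \<in> even_signs"
    by (auto simp: bij_triple_iff)
  have "(\<forall>i. triple x y z i = 1 \<or> triple x y z i = -1) \<and> prod (triple x y z) UNIV = 1"
    using A(3) by (auto simp: even_signs_def forall_3 prod_UNIV_3)
  then show "A \<in> evenly_signed"
    unfolding evenly_signed_def using A by blast
qed

abbreviation signed_perm3 :: "3 \<Rightarrow> 3 \<Rightarrow> 3 \<Rightarrow> real \<Rightarrow> real \<Rightarrow> real \<Rightarrow> real^3^3"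
  where "signed_perm3 a b c x y z \<equiv> signed_perm (triple a b c) (triple x y z)"

lemma signed_perm_rows: "signed_perm (triple a b c) s $ 1 $ j = (if j = a then s 1 else 0)"
 "signed_perm (triple a b c) s $ 2 $ j = (if j = b then s 2 else 0)"
 "signed_perm (triple a b c) s $ 3 $ j = (if j = c then s 3 else 0)"
  by (simp_all add: signed_perm_def)

text \<open>As the signs multiply to \<open>1\<close>, the determinant is the signature of the permutation. It
  separates \<open>\<bbbT>\<close> from its coset in \<open>\<bbbO>\<^sup>-\<close>.\<close>

lemma det_signed_perm3:
  assumes "(x,y,z) \<in> even_signs"
  shows "(a,b,c) \<in> even_perms \<Longrightarrow> det (signed_perm3 a b c x y z) = 1"
    and "(a,b,c) \<in> odd_perms \<Longrightarrow> det (signed_perm3 a b c x y z) = -1"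
proof -
  have xyz: "x * (y * z) = 1" using assms by (auto simp: even_signs_def)
  show "(a,b,c) \<in> even_perms \<Longrightarrow> det (signed_perm3 a b c x y z) = 1"
    unfolding even_perms_def insert_iff prod.inject empty_iff
    by (elim disjE conjE; simp add: det_3 signed_perm_rows xyz mult_ac)
  show "(a,b,c) \<in> odd_perms \<Longrightarrow> det (signed_perm3 a b c x y z) = -1"
    unfolding odd_perms_def insert_iff prod.inject empty_iff
    by (elim disjE conjE; simp add: det_3 signed_perm_rows xyz mult_ac)
qed

lemma mat_1_signed_perm3: "mat 1 = signed_perm3 1 2 3 1 1 1"
  by (simp add: vec_eq_iff forall_3 signed_perm_rows mat_def)

lemma signed_perm3_mult: "signed_perm3 a b c x y z ** signed_perm3 a' b' c' x' y' z' =
  signed_perm3 (triple a' b' c' a) (triple a' b' c' b) (triple a' b' c' c) (x * triple x' y' z' a) (y * triple x' y' z' b) (z * triple x' y' z' c)"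
  by (simp only: signed_perm_mult) (rule arg_cong2[of _ _ _ _ signed_perm]; simp add: fun_eq_iff forall_3)

lemma rot_e3_values:
  "rot e3 0 = signed_perm3 1 2 3 1 1 1"
  "rot e3 pi = signed_perm3 1 2 3 (-1) (-1) 1"
  "- rot e3 (pi / 2) = signed_perm3 2 1 3 1 (-1) (-1)"
  by (simp_all add: rot_e3 vec_eq_iff forall_3 signed_perm_rows)

lemma rot_e1_pi: "rot e1 pi = signed_perm3 1 2 3 1 (-1) (-1)"
proof -
  have u: "sgn e1 $ 1 = 1" "sgn e1 $ 2 = 0" "sgn e1 $ 3 = 0"
  proof -
    have "sgn e1 = e1" by (simp add: e1_def sgn_div_norm)
    then show "sgn e1 $ 1 = 1" "sgn e1 $ 2 = 0" "sgn e1 $ 3 = 0"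
      by (simp_all only:) (simp_all add: e1_def axis_def)
  qed
  show ?thesis by (simp add: rot_matrix u vec_eq_iff forall_3 signed_perm_rows)
qed

text \<open>The rotations of order three about the line spanned by \<open>(1,1,1)\<close> permute the coordinate axes
  cyclically.\<close>

lemma rot_diagonal:
  assumes "sgn n $ 1 = 1 / sqrt 3" "sgn n $ 2 = 1 / sqrt 3" "sgn n $ 3 = 1 / sqrt 3"
  shows "rot n (2 * pi / 3) = signed_perm3 3 1 2 1 1 1" "rot n (4 * pi / 3) = signed_perm3 2 3 1 1 1 1"
proof -
  have "4 * pi / 3 = pi + pi / 3" by simp
  then have "cos (4 * pi / 3) = - 1 / 2" "sin (4 * pi / 3) = - (sqrt 3 / 2)"
    by (simp_all only: cos_add sin_add) (simp_all add: cos_60 sin_60)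
  then show "rot n (2 * pi / 3) = signed_perm3 3 1 2 1 1 1" "rot n (4 * pi / 3) = signed_perm3 2 3 1 1 1 1"
    by (simp_all only: rot_matrix assms cos_120 sin_120)
       (simp_all add: vec_eq_iff forall_3 signed_perm_rows)
qed

lemma rot_111: "rot (e1 + e2 + e3) (2 * pi / 3) = signed_perm3 3 1 2 1 1 1"
proof (rule rot_diagonal)
  have "(e1 + e2 + e3) $ i = 1" for i
    using exhaust_3[of i] by (auto simp: e1_def e2_def e3_def axis_def)
  moreover from this have "norm (e1 + e2 + e3) = sqrt 3"
    by (simp only: norm_eq_sqrt_inner inner_vec_def sum_3) simp
  ultimately have "sgn (e1 + e2 + e3) $ i = 1 / sqrt 3" for i
    by (simp only: sgn_div_norm vector_scaleR_component) (simp add: divide_inverse)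
  then show "sgn (e1 + e2 + e3) $ 1 = 1 / sqrt 3" "sgn (e1 + e2 + e3) $ 2 = 1 / sqrt 3"
    "sgn (e1 + e2 + e3) $ 3 = 1 / sqrt 3" by simp_all
qed

lemma signed_perm3_evenly_signed: "(a,b,c) \<in> even_perms \<union> odd_perms \<Longrightarrow> (x,y,z) \<in> even_signs \<Longrightarrow> signed_perm3 a b c x y z \<in> evenly_signed"
  unfolding evenly_signed_iff by blast

text \<open>The half-turns generate the diagonal sign matrices, the threefold rotation generates the cyclic
  permutations, and a signed permutation is the product of its sign and permutation parts.\<close>

lemma signed_perm3_tetrahedral:
  assumes "(a,b,c) \<in> even_perms" "(x,y,z) \<in> even_signs"
  shows "signed_perm3 a b c x y z \<in> tetrahedral"
proof -
  let ?C = "signed_perm3 3 1 2 1 1 1"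
  have gen: "A \<in> tetrahedral" if "A \<in> {signed_perm3 1 2 3 (-1) (-1) 1, signed_perm3 1 2 3 1 (-1) (-1), ?C}" for A
    using that unfolding tetrahedral_def rot_e3_values rot_e1_pi rot_111
    by (rule generate.incl)
  have mult: "A ** B \<in> tetrahedral" if "A \<in> tetrahedral" "B \<in> tetrahedral" for A B
    using that generate.eng[of A O3 _ B] unfolding tetrahedral_def by (simp add: O3_mult)
  have "signed_perm3 1 2 3 (-1) (-1) 1 ** signed_perm3 1 2 3 1 (-1) (-1) \<in> tetrahedral"
    by (intro mult gen) simp_all
  then have 2: "signed_perm3 1 2 3 (-1) 1 (-1) \<in> tetrahedral"
    by (simp add: signed_perm3_mult)
  have "mat 1 \<in> tetrahedral"
    unfolding tetrahedral_def using generate.one[of O3] by (simp add: O3_def)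
  then have signs: "signed_perm3 1 2 3 x y z \<in> tetrahedral"
    using 2 gen assms(2) unfolding mat_1_signed_perm3 even_signs_def by auto
  have "?C ** ?C \<in> tetrahedral"
    by (intro mult gen) simp_all
  then have "signed_perm3 2 3 1 1 1 1 \<in> tetrahedral"
    by (simp add: signed_perm3_mult)
  then have perms: "signed_perm3 a b c 1 1 1 \<in> tetrahedral"
    using gen assms(1) signs \<open>mat 1 \<in> tetrahedral\<close> unfolding mat_1_signed_perm3 even_perms_def by auto
  have "signed_perm3 a b c x y z = signed_perm3 1 2 3 x y z ** signed_perm3 a b c 1 1 1"
    by (simp add: signed_perm3_mult)
  then show ?thesis
    using mult[OF signs perms] by simp
qed

text \<open>For an odd permutation, dividing by the coset representative
  \<open>-\<^bold>r(e\<^sub>3, \<pi>/2)\<close>, itself an odd signed permutation, leaves an element of \<open>\<bbbT>\<close>.\<close>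

lemma octahedral_minus_eq: "octahedral_minus = evenly_signed"
proof (intro equalityI subsetI)
  interpret group O3 by (rule O3_group)
  have r: "- rot e3 (pi / 2) \<in> evenly_signed"
    unfolding rot_e3_values by (rule signed_perm3_evenly_signed) (simp_all add: odd_perms_def even_signs_def)
  have "{rot e3 pi, rot e1 pi, rot (e1 + e2 + e3) (2 * pi / 3)} \<subseteq> evenly_signed"
    unfolding rot_e3_values rot_e1_pi rot_111
    by (auto intro!: signed_perm3_evenly_signed simp: even_perms_def even_signs_def)
  then have T: "tetrahedral \<subseteq> evenly_signed"
    unfolding tetrahedral_def using evenly_signed_subgroup by (rule generate_subgroup_incl)
  fix A assume "A \<in> octahedral_minus"
  then show "A \<in> evenly_signed"
    using T r evenly_signed_mult unfolding octahedral_minus_def l_coset_def O3_mult by blast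
next
  fix A :: "real^3^3" assume "A \<in> evenly_signed"
  then obtain a b c x y z where A: "A = signed_perm3 a b c x y z" and p: "(a,b,c) \<in> even_perms \<union> odd_perms"
    and s: "(x,y,z) \<in> even_signs"
    unfolding evenly_signed_iff by blast
  show "A \<in> octahedral_minus"
  proof (cases "(a,b,c) \<in> even_perms")
    case True
    then show ?thesis using signed_perm3_tetrahedral s by (simp add: A octahedral_minus_def)
  next
    case False
    then have "(b,a,c) \<in> even_perms" using p by (auto simp: even_perms_def odd_perms_def)
    moreover have "(-y,x,-z) \<in> even_signs" using s by (auto simp: even_signs_def)
    ultimately have "signed_perm3 b a c (-y) x (-z) \<in> tetrahedral" by (rule signed_perm3_tetrahedral)
    moreover have "A = - rot e3 (pi / 2) ** signed_perm3 b a c (-y) x (-z)"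
      unfolding rot_e3_values A by (simp add: signed_perm3_mult)
    ultimately show ?thesis
      unfolding octahedral_minus_def l_coset_def O3_mult by blast
  qed
qed

section \<open>Stabilizers of vectors in the chamber\<close>

text \<open>The equations \<open>A n = det A n\<close> for \<open>n = (p, q, r)\<close>, one item per permutation: the even
  ones first, then the odd ones. The order \<open>0 \<le> p \<le> q \<le> r\<close> turns each system
  into sign conditions and coincidences of coordinates; the last transposition, exchanging the outer
  coordinates, fixes no pseudovector of the chamber.\<close>

lemma chamber_equations:
  fixes p q r x y z :: real
  assumes sc: "(x = 1 \<and> y = 1 \<and> z = 1) \<or> (x = 1 \<and> y = -1 \<and> z = -1) \<or> (x = -1 \<and> y = 1 \<and> z = -1) \<or> (x = -1 \<and> y = -1 \<and> z = 1)"
   and n: "0 \<le> p" "p \<le> q" "q \<le> r" "0 < r"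
  shows "x * p = p \<Longrightarrow> y * q = q \<Longrightarrow> z * r = r \<Longrightarrow> x = 1 \<and> y = 1 \<and> z = 1 \<or> x = -1 \<and> y = -1 \<and> z = 1 \<and> p = 0 \<and> q = 0"
  and "x * q = p \<Longrightarrow> y * r = q \<Longrightarrow> z * p = r \<Longrightarrow> x = 1 \<and> y = 1 \<and> z = 1 \<and> p = q \<and> q = r"
  and "x * r = p \<Longrightarrow> y * p = q \<Longrightarrow> z * q = r \<Longrightarrow> x = 1 \<and> y = 1 \<and> z = 1 \<and> p = q \<and> q = r"
  and "x * q = -p \<Longrightarrow> y * p = -q \<Longrightarrow> z * r = -r \<Longrightarrow> x = -y \<and> z = -1 \<and> p = 0 \<and> q = 0"
  and "x * p = -p \<Longrightarrow> y * r = -q \<Longrightarrow> z * q = -r \<Longrightarrow> x = 1 \<and> y = -1 \<and> z = -1 \<and> p = 0 \<and> q = r"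
  and "x * r = -p \<Longrightarrow> y * q = -q \<Longrightarrow> z * p = -r \<Longrightarrow> False"
  using assms by - ((elim disjE conjE; simp)+)

text \<open>The three alternatives after \<open>mat 1\<close> put \<open>n\<close> on the rays of \<open>(0,0,1)\<close>, \<open>(0,1,1)\<close> and
  \<open>(1,1,1)\<close>. These rays are disjoint, so on each of them the listed matrices and the
  identity are all the candidates for the stabilizer.\<close>

lemma stabilizer_chamber_cases:
  assumes A: "A \<in> evenly_signed \<inter> axial n" and n: "0 \<le> n $ 1" "n $ 1 \<le> n $ 2" "n $ 2 \<le> n $ 3" "n $ 3 > 0"
  shows "A = mat 1
    \<or> n $ 1 = 0 \<and> n $ 2 = 0 \<and> A \<in> {signed_perm3 1 2 3 (-1) (-1) 1, signed_perm3 2 1 3 1 (-1) (-1), signed_perm3 2 1 3 (-1) 1 (-1)}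
    \<or> n $ 1 = 0 \<and> n $ 2 = n $ 3 \<and> A = signed_perm3 1 3 2 1 (-1) (-1)
    \<or> n $ 1 = n $ 2 \<and> n $ 2 = n $ 3 \<and> A \<in> {signed_perm3 3 1 2 1 1 1, signed_perm3 2 3 1 1 1 1}"
proof -
  obtain a b c x y z where A': "A = signed_perm3 a b c x y z" and p: "(a,b,c) \<in> even_perms \<union> odd_perms"
    and s: "(x,y,z) \<in> even_signs"
    using IntD1[OF A] unfolding evenly_signed_iff by blast
  have fixed: "A *v n = det A *\<^sub>R n" using IntD2[OF A] by (simp add: axial_def)
  have eq: "x * n $ a = det A * n $ 1" "y * n $ b = det A * n $ 2" "z * n $ c = det A * n $ 3"
    using arg_cong[OF fixed, of "\<lambda>v. v $ 1"] arg_cong[OF fixed, of "\<lambda>v. v $ 2"] arg_cong[OF fixed, of "\<lambda>v. v $ 3"]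
    by (simp_all add: A' signed_perm_mult_vec)
  have sc: "(x = 1 \<and> y = 1 \<and> z = 1) \<or> (x = 1 \<and> y = -1 \<and> z = -1) \<or> (x = -1 \<and> y = 1 \<and> z = -1) \<or> (x = -1 \<and> y = -1 \<and> z = 1)"
    using s by (auto simp: even_signs_def)
  show ?thesis
  proof (cases "(a,b,c) \<in> even_perms")
    case True
    then have d: "det A = 1" using det_signed_perm3(1) s A' by simp
    consider "a = 1" "b = 2" "c = 3" | "a = 2" "b = 3" "c = 1" | "a = 3" "b = 1" "c = 2"
      using True by (auto simp: even_perms_def)
    then show ?thesis
    proof cases
      case 1
      have "x * n $ 1 = n $ 1" "y * n $ 2 = n $ 2" "z * n $ 3 = n $ 3"
        using eq unfolding 1 d by simp_all
      from chamber_equations(1)[OF sc n this] show ?thesis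
        unfolding A' mat_1_signed_perm3 1 by auto
    next
      case 2
      have "x * n $ 2 = n $ 1" "y * n $ 3 = n $ 2" "z * n $ 1 = n $ 3"
        using eq unfolding 2 d by simp_all
      from chamber_equations(2)[OF sc n this] show ?thesis
        unfolding A' mat_1_signed_perm3 2 by auto
    next
      case 3
      have "x * n $ 3 = n $ 1" "y * n $ 1 = n $ 2" "z * n $ 2 = n $ 3"
        using eq unfolding 3 d by simp_all
      from chamber_equations(3)[OF sc n this] show ?thesis
        unfolding A' mat_1_signed_perm3 3 by auto
    qed
  next
    case False
    then have odd: "(a,b,c) \<in> odd_perms" using p by simp
    then have d: "det A = -1" using det_signed_perm3(2) s A' by simp
    consider "a = 2" "b = 1" "c = 3" | "a = 1" "b = 3" "c = 2" | "a = 3" "b = 2" "c = 1"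
      using odd by (auto simp: odd_perms_def)
    then show ?thesis
    proof cases
      case 1
      have "x * n $ 2 = - n $ 1" "y * n $ 1 = - n $ 2" "z * n $ 3 = - n $ 3"
        using eq unfolding 1 d by simp_all
      from chamber_equations(4)[OF sc n this] show ?thesis
        unfolding A' mat_1_signed_perm3 1 using sc by auto
    next
      case 2
      have "x * n $ 1 = - n $ 1" "y * n $ 3 = - n $ 2" "z * n $ 2 = - n $ 3"
        using eq unfolding 2 d by simp_all
      from chamber_equations(5)[OF sc n this] show ?thesis
        unfolding A' mat_1_signed_perm3 2 by auto
    next
      case 3
      have "x * n $ 3 = - n $ 1" "y * n $ 2 = - n $ 2" "z * n $ 1 = - n $ 3"
        using eq unfolding 3 d by simp_all
      from chamber_equations(6)[OF sc n this] show ?thesis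
        unfolding A' mat_1_signed_perm3 3 by auto
    qed
  qed
qed

text \<open>A signed permutation can replace the coordinates by their absolute values in increasing order.\<close>

lemma move_to_chamber:
  fixes n :: "real^3"
  obtains B where "B \<in> hyperoctahedral" "0 \<le> (B *v n) $ 1" "(B *v n) $ 1 \<le> (B *v n) $ 2" "(B *v n) $ 2 \<le> (B *v n) $ 3"
proof -
  let ?f = "\<lambda>i. \<bar>n $ i\<bar>"
  have "\<exists>a b c. bij (triple a b c) \<and> ?f a \<le> ?f b \<and> ?f b \<le> ?f c"
  proof -
    consider "?f 1 \<le> ?f 2 \<and> ?f 2 \<le> ?f 3" | "?f 1 \<le> ?f 3 \<and> ?f 3 \<le> ?f 2" | "?f 2 \<le> ?f 1 \<and> ?f 1 \<le> ?f 3"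
      | "?f 2 \<le> ?f 3 \<and> ?f 3 \<le> ?f 1" | "?f 3 \<le> ?f 1 \<and> ?f 1 \<le> ?f 2" | "?f 3 \<le> ?f 2 \<and> ?f 2 \<le> ?f 1"
      by linarith
    then show ?thesis
      unfolding bij_triple
    proof cases
      case 1 then show "\<exists>a b c. (a \<noteq> b \<and> a \<noteq> c \<and> b \<noteq> c) \<and> ?f a \<le> ?f b \<and> ?f b \<le> ?f c"
        by (intro exI[of _ 1] exI[of _ 2] exI[of _ 3]) simp
    next
      case 2 then show "\<exists>a b c. (a \<noteq> b \<and> a \<noteq> c \<and> b \<noteq> c) \<and> ?f a \<le> ?f b \<and> ?f b \<le> ?f c"
        by (intro exI[of _ 1] exI[of _ 3] exI[of _ 2]) simp
    next
      case 3 then show "\<exists>a b c. (a \<noteq> b \<and> a \<noteq> c \<and> b \<noteq> c) \<and> ?f a \<le> ?f b \<and> ?f b \<le> ?f c"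
        by (intro exI[of _ 2] exI[of _ 1] exI[of _ 3]) simp
    next
      case 4 then show "\<exists>a b c. (a \<noteq> b \<and> a \<noteq> c \<and> b \<noteq> c) \<and> ?f a \<le> ?f b \<and> ?f b \<le> ?f c"
        by (intro exI[of _ 2] exI[of _ 3] exI[of _ 1]) simp
    next
      case 5 then show "\<exists>a b c. (a \<noteq> b \<and> a \<noteq> c \<and> b \<noteq> c) \<and> ?f a \<le> ?f b \<and> ?f b \<le> ?f c"
        by (intro exI[of _ 3] exI[of _ 1] exI[of _ 2]) simp
    next
      case 6 then show "\<exists>a b c. (a \<noteq> b \<and> a \<noteq> c \<and> b \<noteq> c) \<and> ?f a \<le> ?f b \<and> ?f b \<le> ?f c"
        by (intro exI[of _ 3] exI[of _ 2] exI[of _ 1]) simp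
    qed
  qed
  then obtain a b c where abc: "bij (triple a b c)" "?f a \<le> ?f b" "?f b \<le> ?f c" by blast
  \<comment> \<open>With these signs each coordinate of the image is an absolute value of a coordinate of \<open>n\<close>.\<close>
  define s where "s = (\<lambda>i. if n $ triple a b c i < 0 then -1 else 1 :: real)"
  have "(signed_perm (triple a b c) s *v n) $ i = ?f (triple a b c i)" for i
    by (simp add: signed_perm_mult_vec s_def)
  moreover have "signed_perm (triple a b c) s \<in> hyperoctahedral"
    unfolding hyperoctahedral_def using abc(1)
    by (intro CollectI exI[of _ "triple a b c"] exI[of _ s]) (simp add: s_def)
  ultimately show thesis
    using abc by (intro that[of "signed_perm (triple a b c) s"]) simp_all
qed

lemma conj_class_stabilizer_invariant:
  assumes "B \<in> hyperoctahedral"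
  shows "conj_class (evenly_signed \<inter> axial (B *v n)) = conj_class (evenly_signed \<inter> axial n)"
proof -
  have B: "orthogonal_matrix B" using assms by (rule hyperoctahedral_orthogonal)
  then have BC: "B \<in> carrier O3" by (simp add: O3_def)
  have sub: "evenly_signed \<subseteq> carrier O3" "axial n \<subseteq> carrier O3"
    using evenly_signed_subgroup axial_subgroup subgroup.subset by blast+
  have "conj_subgroup B (evenly_signed \<inter> axial n) = evenly_signed \<inter> axial (B *v n)"
    using conj_subgroup_Int[OF BC sub] by (simp add: conj_subgroup_evenly_signed[OF assms] conj_subgroup_axial[OF B])
  then show ?thesis
    using conj_class_conj_subgroup[OF BC, of "evenly_signed \<inter> axial n"] sub by auto
qed

lemma signed_perm3_axial:
  assumes "(x,y,z) \<in> even_signs"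
   and "(a,b,c) \<in> even_perms \<and> d = 1 \<or> (a,b,c) \<in> odd_perms \<and> d = -1"
   and "x * n $ a = d * n $ 1" "y * n $ b = d * n $ 2" "z * n $ c = d * n $ 3"
  shows "signed_perm3 a b c x y z \<in> evenly_signed \<inter> axial n"
proof -
  have H: "signed_perm3 a b c x y z \<in> evenly_signed" using assms by (intro signed_perm3_evenly_signed) auto
  moreover have "det (signed_perm3 a b c x y z) = d" using assms det_signed_perm3 by blast
  moreover have "signed_perm3 a b c x y z *v n = d *\<^sub>R n"
    using assms by (simp add: vec_eq_iff forall_3 signed_perm_mult_vec)
  ultimately show ?thesis
    using hyperoctahedral_orthogonal evenly_signed_subset by (auto simp: axial_def)
qed

text \<open>The hypothesis \<open>n\<^sub>2 > 0\<close> excludes the ray of \<open>e\<^sub>3\<close>, and the two disjunctions exclude those of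
  \<open>(0,1,1)\<close> and \<open>(1,1,1)\<close>.\<close>

lemma stabilizer_generic:
  assumes n: "0 \<le> n $ 1" "n $ 1 \<le> n $ 2" "n $ 2 \<le> n $ 3" "n $ 2 > 0"
    "n $ 1 \<noteq> 0 \<or> n $ 2 \<noteq> n $ 3" "n $ 1 \<noteq> n $ 2 \<or> n $ 2 \<noteq> n $ 3"
  shows "evenly_signed \<inter> axial n = trivial_subgroup"
proof -
  have "mat 1 \<in> evenly_signed \<inter> axial n"
    unfolding mat_1_signed_perm3 by (rule signed_perm3_axial[where d = 1]) (simp_all add: even_signs_def even_perms_def)
  moreover have "A = mat 1" if "A \<in> evenly_signed \<inter> axial n" for A
    using stabilizer_chamber_cases[OF that] n by auto
  ultimately show ?thesis unfolding trivial_subgroup_def by blast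
qed

lemma stabilizer_fourfold_axis:
  assumes n: "n $ 1 = 0" "n $ 2 = 0" "n $ 3 > 0"
  shows "evenly_signed \<inter> axial n = cyclic_minus 2"
proof -
  have "{j::nat. j < 2} = {0, 1}" by auto
  then have "cyclic 2 = (\<lambda>j. rot e3 (2 * real j * pi / real 2)) ` {0, 1}"
    unfolding cyclic_def by blast
  then have c: "cyclic 2 = {signed_perm3 1 2 3 1 1 1, signed_perm3 1 2 3 (-1) (-1) 1}"
    by (simp add: rot_e3_values)
  have cm: "cyclic_minus 2 = {signed_perm3 1 2 3 1 1 1, signed_perm3 1 2 3 (-1) (-1) 1, signed_perm3 2 1 3 1 (-1) (-1), signed_perm3 2 1 3 (-1) 1 (-1)}"
    by (simp add: cyclic_minus_def c rot_e3_values l_coset_def O3_mult signed_perm3_mult) blast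
  have "signed_perm3 1 2 3 1 1 1 \<in> evenly_signed \<inter> axial n" "signed_perm3 1 2 3 (-1) (-1) 1 \<in> evenly_signed \<inter> axial n"
    by (rule signed_perm3_axial[where d = 1]; simp add: even_signs_def even_perms_def n)+
  moreover have "signed_perm3 2 1 3 1 (-1) (-1) \<in> evenly_signed \<inter> axial n" "signed_perm3 2 1 3 (-1) 1 (-1) \<in> evenly_signed \<inter> axial n"
    by (rule signed_perm3_axial[where d = "-1"]; simp add: even_signs_def odd_perms_def n)+
  ultimately have "cyclic_minus 2 \<subseteq> evenly_signed \<inter> axial n" unfolding cm by blast
  moreover have "evenly_signed \<inter> axial n \<subseteq> cyclic_minus 2"
  proof
    fix A assume "A \<in> evenly_signed \<inter> axial n"
    from stabilizer_chamber_cases[OF this] n show "A \<in> cyclic_minus 2"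
      unfolding cm mat_1_signed_perm3 by auto
  qed
  ultimately show ?thesis by blast
qed

lemma stabilizer_mirror_normal:
  assumes n: "n $ 1 = 0" "n $ 2 = n $ 3" "n $ 3 > 0"
  shows "evenly_signed \<inter> axial n = {mat 1, signed_perm3 1 3 2 1 (-1) (-1)}"
proof -
  have "signed_perm3 1 2 3 1 1 1 \<in> evenly_signed \<inter> axial n"
    by (rule signed_perm3_axial[where d = 1]; simp add: even_signs_def even_perms_def n)
  moreover have "signed_perm3 1 3 2 1 (-1) (-1) \<in> evenly_signed \<inter> axial n"
    by (rule signed_perm3_axial[where d = "-1"]; simp add: even_signs_def odd_perms_def n)
  moreover have "A \<in> {mat 1, signed_perm3 1 3 2 1 (-1) (-1)}" if "A \<in> evenly_signed \<inter> axial n" for A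
    using stabilizer_chamber_cases[OF that] n by auto
  ultimately show ?thesis unfolding mat_1_signed_perm3 by blast
qed

lemma stabilizer_threefold_axis:
  assumes n: "n $ 1 = n $ 2" "n $ 2 = n $ 3" "n $ 3 > 0"
  shows "evenly_signed \<inter> axial n = {mat 1, signed_perm3 3 1 2 1 1 1, signed_perm3 2 3 1 1 1 1}"
proof -
  have "signed_perm3 1 2 3 1 1 1 \<in> evenly_signed \<inter> axial n" "signed_perm3 3 1 2 1 1 1 \<in> evenly_signed \<inter> axial n" "signed_perm3 2 3 1 1 1 1 \<in> evenly_signed \<inter> axial n"
    by (rule signed_perm3_axial[where d = 1]; simp add: even_signs_def even_perms_def n)+
  moreover have "A \<in> {mat 1, signed_perm3 3 1 2 1 1 1, signed_perm3 2 3 1 1 1 1}" if "A \<in> evenly_signed \<inter> axial n" for A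
    using stabilizer_chamber_cases[OF that] n by auto
  ultimately show ?thesis unfolding mat_1_signed_perm3 by blast
qed

section \<open>Identification of the conjugacy classes\<close>

text \<open>Choosing \<open>g\<close> of determinant \<open>1\<close> keeps the sense of rotation.\<close>

lemma rotation_onto:
  assumes "norm n = 1"
  obtains g where "orthogonal_matrix g" "g *v e3 = n"
    "\<And>\<theta>. g ** rot e3 \<theta> ** transpose g = rot n \<theta>"
proof -
  obtain g :: "real^3^3" where g: "rotation_matrix g" "g *v axis 3 1 = n"
    using rotation_matrix_exists_basis[of n 3] assms by auto
  then have "orthogonal_matrix g" "det g = 1" "g *v e3 = n"
    by (simp_all add: rotation_matrix_def e3_def)
  then show thesis using that conjugate_rot[of g e3] by simp
qed

lemma rot_0: "rot n 0 = mat 1"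
  unfolding matrix_eq by (simp add: rot_apply)

text \<open>The negative of a half-turn about \<open>n\<close> is the reflection in the plane orthogonal to \<open>n\<close>; for
  \<open>n\<close> along \<open>(0,1,1)\<close> it maps \<open>(x\<^sub>1, x\<^sub>2, x\<^sub>3)\<close> to \<open>(x\<^sub>1, -x\<^sub>3, -x\<^sub>2)\<close>.\<close>

lemma conj_class_mirror_pair:
  fixes n :: "real^3"
  assumes "norm n = 1" "n $ 1 = 0" "n $ 2 = n $ 3"
  shows "conj_class {mat 1, signed_perm3 1 3 2 1 (-1) (-1)} = conj_class (cyclic_minus 1)"
proof -
  obtain g where g: "orthogonal_matrix g" "\<And>\<theta>. g ** rot e3 \<theta> ** transpose g = rot n \<theta>"
    using rotation_onto assms(1) by blast
  have "{j::nat. j < 1} = {0}" by auto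
  then have "cyclic 1 = (\<lambda>j. rot e3 (2 * real j * pi / real 1)) ` {0}"
    unfolding cyclic_def by blast
  then have cm: "cyclic_minus 1 = {rot e3 0, - rot e3 pi}"
    by (simp add: cyclic_minus_def l_coset_def O3_mult rot_0) blast
  have "(n $ 3)\<^sup>2 * 2 = 1"
    using assms(1) by (simp add: norm_eq_sqrt_inner inner_vec_def sum_3 assms(2,3) power2_eq_square)
  moreover have "sgn n = n" using assms(1) by (simp add: sgn_div_norm)
  ultimately have reflection: "- rot n pi = signed_perm3 1 3 2 1 (-1) (-1)"
    by (simp add: rot_matrix vec_eq_iff forall_3 signed_perm_rows assms(2,3) power2_eq_square)
  have "g ** - rot e3 pi ** transpose g = - (g ** rot e3 pi ** transpose g)"
    by (simp add: vec_eq_iff matrix_matrix_mult_def sum_negf)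
  then have "conj_subgroup g (cyclic_minus 1) = {mat 1, signed_perm3 1 3 2 1 (-1) (-1)}"
    unfolding cm by (simp add: conj_subgroup_O3[OF g(1)] g(2) rot_0 g(1)[unfolded orthogonal_matrix_def] reflection)
  moreover have "cyclic_minus 1 \<subseteq> carrier O3"
    unfolding cm using rot_e3_axial[of 0] rot_e3_axial[of pi]
    by (simp add: axial_def O3_def orthogonal_matrix_uminus)
  ultimately show ?thesis
    using conj_class_conj_subgroup[of g "cyclic_minus 1"] g(1) by (simp add: O3_def)
qed

lemma conj_class_threefold:
  fixes n :: "real^3"
  assumes "norm n = 1" "n $ 1 = n $ 2" "n $ 2 = n $ 3" "n $ 3 > 0"
  shows "conj_class {mat 1, signed_perm3 3 1 2 1 1 1, signed_perm3 2 3 1 1 1 1} = conj_class (cyclic 3)"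
proof -
  obtain g where g: "orthogonal_matrix g" "\<And>\<theta>. g ** rot e3 \<theta> ** transpose g = rot n \<theta>"
    using rotation_onto assms(1) by blast
  have "{j::nat. j < 3} = {0, 1, 2}" by auto
  then have "cyclic 3 = (\<lambda>j. rot e3 (2 * real j * pi / real 3)) ` {0, 1, 2}"
    unfolding cyclic_def by blast
  then have c: "cyclic 3 = {rot e3 0, rot e3 (2 * pi / 3), rot e3 (4 * pi / 3)}"
    by simp
  have "sqrt 3 * n $ 3 = 1"
  proof -
    have "norm n = sqrt (3 * (n $ 3)\<^sup>2)"
      by (simp add: norm_eq_sqrt_inner inner_vec_def sum_3 assms(2,3) power2_eq_square)
    then show ?thesis using assms(1,4) by (simp add: real_sqrt_mult)
  qed
  then have "n $ 3 = 1 / sqrt 3" by (simp add: field_simps)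
  moreover have "sgn n = n" using assms(1) by (simp add: sgn_div_norm)
  ultimately have "rot n (2 * pi / 3) = signed_perm3 3 1 2 1 1 1" "rot n (4 * pi / 3) = signed_perm3 2 3 1 1 1 1"
    by (intro rot_diagonal; simp add: assms(2,3))+
  then have "conj_subgroup g (cyclic 3) = {mat 1, signed_perm3 3 1 2 1 1 1, signed_perm3 2 3 1 1 1 1}"
    unfolding c by (simp add: conj_subgroup_O3[OF g(1)] g(2) rot_0 g(1)[unfolded orthogonal_matrix_def])
  moreover have "cyclic 3 \<subseteq> carrier O3"
    unfolding c using rot_e3_axial by (simp add: axial_def O3_def)
  ultimately show ?thesis
    using conj_class_conj_subgroup[of g "cyclic 3"] g(1) by (simp add: O3_def)
qed

text \<open>Every unit vector has the form \<open>g e\<^sub>3\<close> with \<open>g\<close> orthogonal.\<close>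

lemma clips_eq_stabilizers:
  "clips (conj_class octahedral_minus) (conj_class (plus_Z2c SO2)) =
    {conj_class (evenly_signed \<inter> axial n) | n. norm n = 1}"
proof -
  have norm_g: "norm (g *v e3) = 1" if "orthogonal_matrix g" for g
    using that by (simp add: orthogonal_matrix_norm e3_def)
  have "clips (conj_class octahedral_minus) (conj_class (plus_Z2c SO2)) =
    {conj_class (evenly_signed \<inter> conj_subgroup g (axial e3)) | g. g \<in> carrier O3}"
    unfolding octahedral_minus_eq plus_Z2c_SO2_eq
    using evenly_signed_subgroup axial_subgroup by (rule clips_conj_class)
  also have "\<dots> = {conj_class (evenly_signed \<inter> axial (g *v e3)) | g. orthogonal_matrix g}"
    by (auto simp: O3_def conj_subgroup_axial) (metis conj_subgroup_axial)
  also have "\<dots> = {conj_class (evenly_signed \<inter> axial n) | n. norm n = 1}"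
    using norm_g rotation_onto by blast
  finally show ?thesis .
qed

theorem lemma4p24:
  "clips (conj_class octahedral_minus) (conj_class (plus_Z2c SO2)) =
    {conj_class trivial_subgroup, conj_class (cyclic 3),
     conj_class (cyclic_minus 1), conj_class (cyclic_minus 2)}"
proof -
  have cases: "conj_class (evenly_signed \<inter> axial n) =
    (if n $ 2 = 0 then conj_class (cyclic_minus 2)
     else if n $ 1 = 0 \<and> n $ 2 = n $ 3 then conj_class (cyclic_minus 1)
     else if n $ 1 = n $ 2 \<and> n $ 2 = n $ 3 then conj_class (cyclic 3)
     else conj_class trivial_subgroup)"
    if n: "norm n = 1" "0 \<le> n $ 1" "n $ 1 \<le> n $ 2" "n $ 2 \<le> n $ 3" for n
  proof -
    have "n $ 3 > 0"
    proof (rule ccontr)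
      assume "\<not> n $ 3 > 0"
      then have "n = 0" using n by (simp add: vec_eq_iff forall_3)
      then show False using n by simp
    qed
    then show ?thesis
      using n stabilizer_fourfold_axis[of n] stabilizer_mirror_normal[of n] stabilizer_threefold_axis[of n] stabilizer_generic[of n]
        conj_class_mirror_pair[of n] conj_class_threefold[of n]
      by auto
  qed
  let ?S = "{conj_class trivial_subgroup, conj_class (cyclic 3),
    conj_class (cyclic_minus 1), conj_class (cyclic_minus 2)}"
  have among: "conj_class (evenly_signed \<inter> axial n) \<in> ?S" if "norm n = 1" for n
  proof -
    obtain B where B: "B \<in> hyperoctahedral" "0 \<le> (B *v n) $ 1" "(B *v n) $ 1 \<le> (B *v n) $ 2" "(B *v n) $ 2 \<le> (B *v n) $ 3"
      by (rule move_to_chamber)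
    have "norm (B *v n) = 1" using that hyperoctahedral_orthogonal[OF B(1)] by (simp add: orthogonal_matrix_norm)
    from cases[OF this B(2-4)] show ?thesis
      unfolding conj_class_stabilizer_invariant[OF B(1)] by simp
  qed
  have attained: "\<exists>n. norm n = 1 \<and> conj_class (evenly_signed \<inter> axial n) = C"
    if "C \<in> ?S" for C
  proof -
    \<comment> \<open>Only rays matter, so witnesses can be given by integer coordinates and normalized.\<close>
    have vec: "norm (sgn v) = 1 \<and> conj_class (evenly_signed \<inter> axial (sgn v)) =
       (if b = 0 then conj_class (cyclic_minus 2)
       else if a = 0 \<and> b = c then conj_class (cyclic_minus 1)
       else if a = b \<and> b = c then conj_class (cyclic 3)
       else conj_class trivial_subgroup)"
      if v: "v = vector [a, b, c]" "0 \<le> a" "a \<le> b" "b \<le> c" "c > 0" for a b c and v :: "real^3"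
    proof -
      have "v $ 3 = c" by (simp add: v(1))
      then have "v \<noteq> 0" using v(5) by auto
      then have "norm v > 0" "norm (sgn v) = 1" by (simp_all add: norm_sgn)
      moreover have "sgn v $ 1 = a / norm v" "sgn v $ 2 = b / norm v" "sgn v $ 3 = c / norm v"
        by (simp_all add: sgn_div_norm v(1) divide_inverse)
      ultimately show ?thesis
        using cases[of "sgn v"] v(2-4) by (simp add: divide_right_mono)
    qed
    \<comment> \<open>One vector on each special ray, and \<open>(1, 2, 3)\<close> in general position.\<close>
    show ?thesis
      using that vec[OF refl, of 0 0 1] vec[OF refl, of 0 1 1] vec[OF refl, of 1 1 1] vec[OF refl, of 1 2 3]
      by auto
  qed
  show ?thesis
    unfolding clips_eq_stabilizers
  proof (intro subset_antisym subsetI)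
    fix C
    assume "C \<in> {conj_class (evenly_signed \<inter> axial n) | n. norm n = 1}"
    then obtain n where "C = conj_class (evenly_signed \<inter> axial n)" "norm n = 1"
      by (elim CollectE exE conjE)
    then show "C \<in> ?S"
      using among[of n] by (simp only:)
  next
    fix C assume "C \<in> ?S"
    from attained[OF this] obtain n where
      "norm n = 1" "conj_class (evenly_signed \<inter> axial n) = C"
      by (elim exE conjE)
    then show "C \<in> {conj_class (evenly_signed \<inter> axial n) | n. norm n = 1}"
      by (intro CollectI exI[of _ n] conjI) (simp_all only:)
  qed
qed

end
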